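(* Let $L_s$, $s\in\mathbb{R}$, be Poincaré sections (with period $\tau$) of the Markovian semigroup $\{P(t)\}_{t\ge0}$ on $\mathbb{X}$, and assume $P(t)$ is a Feller semigroup on $L_0$. Suppose that for some $\nu\in\mathcal P(\mathbb{X})$ with support in $L_0$ and some subsequence $N_i\to\infty$ as $i\to\infty$, $$R_{N_i}^*\nu\to\rho_0\quad\text{weakly as } i\to\infty .$$ Define for $\Gamma\in\mathcal B(\mathbb{X})$: if $s\ge0$, $\rho_s(\Gamma)=\int_{L_0}P(s,x,\Gamma)\rho_0(dx)$; and if $s<0$, $\rho_s(\Gamma)=\rho_{s+k\tau}(\Gamma)$, where $k$ is the smallest integer such that $s+k\tau\ge0$. Then $\{\rho_s\}_{s\in\mathbb{R}}$ is a periodic measure (of period $\tau$) with respect to the semigroup $\{P(t)\}_{t\ge0}$. For each $s\in\mathbb{R}$, $\mathrm{supp}(\rho_s)\subset L_s$; in particular $\rho_s(L_s)=1$.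
   Context: $\mathbb{X}$ is a Polish space with Borel $\sigma$-algebra $\mathcal B(\mathbb{X})$; $\mathcal P(\mathbb{X})$ is the set of Borel probability measures. $\{P(t)\}_{t\ge0}$ is a Markovian semigroup given by transition probabilities $P(t,x,\cdot)$ satisfying the Chapman–Kolmogorov equation, $P(t)\phi(x)=\int_{\mathbb{X}}P(t,x,dy)\phi(y)$. Sets $L_s\subset\mathbb{X}$, $s\ge0$, are Poincaré sections of the transition probability if $L_{s+\tau}=L_s$ and $P(t,x,L_{s+t})=1$ for all $x\in L_s$, $s,t\ge0$; they are extended to all $s\in\mathbb{R}$ by periodicity. The semigroup is stochastically continuous if $\lim_{t\to0}P(t,x,B(x,\gamma))=1$ for all $x\in\mathbb{X}$, $\gamma>0$ ($B(x,\gamma)$ the open ball). A stochastically continuous semigroup is Feller if $P(t)\phi\in C_b(\mathbb{X})$ for all $\phi\in C_b(\mathbb{X})$, $t\ge0$ ($C_b$: bounded continuous functions). Feller on the subset $L_0$ means that $P(t)\phi|_{L_0}\in C_b(L_0)$ for all $\phi\in C_b(\mathbb{X})$, $t\geq 0$. $R_N(x,\Gamma)=\frac1N\sum_{k=1}^NP(k\tau,x,\Gamma)$ and $(R_N^*\nu)(\Gamma)=\int_{\mathbb{X}}R_N(x,\Gamma)\nu(dx)$. A map $\rho:\mathbb{R}\to\mathcal P(\mathbb{X})$ is a periodic measure of period $\tau$ if $\rho_{s+\tau}=\rho_s$ and $\rho_{t+s}(B)=\int_{\mathbb{X}}P(t,x,B)\rho_s(dx)$ for all $s\in\mathbb{R}$,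 $t\ge0$, $B\in\mathcal B(\mathbb{X})$.
   Formalization: Every section L_s is additionally assumed closed; without this the claim fails, e.g. on the real line with P(t,x,·)=δ_{x·exp(-t)}, L_s=(0,∞), ν=δ_1, where the averages converge weakly to δ_0 and every ρ_s is the zero measure. *)

theory Defs
  imports "HOL-Probability.Probability"
begin

abbreviation borel_probs :: "'a::topological_space measure set" where
  "borel_probs \<equiv> space (prob_algebra borel)"

definition Cb :: "'a::topological_space set \<Rightarrow> ('a \<Rightarrow> real) set" where
  "Cb S = {\<phi>. continuous_on S \<phi> \<and> bounded (\<phi> ` S)}"

text \<open>
  The identity \<open>P 0 x = return borel x\<close> is not required, only measurability and the
  Chapman--Kolmogorov equation.
\<close>

definition markov_semigroup :: "(real \<Rightarrow> 'a::polish_space \<Rightarrow> 'a measure) \<Rightarrow> bool" where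
  "markov_semigroup P \<longleftrightarrow>
     (\<forall>t\<ge>0. P t \<in> borel \<rightarrow>\<^sub>M prob_algebra borel) \<and>
     (\<forall>s\<ge>0. \<forall>t\<ge>0. \<forall>x. \<forall>B\<in>sets borel.
        emeasure (P (s + t) x) B = (\<integral>\<^sup>+ y. emeasure (P t y) B \<partial>P s x))"

definition semigroup_op ::
    "(real \<Rightarrow> 'a::polish_space \<Rightarrow> 'a measure) \<Rightarrow> real \<Rightarrow> ('a \<Rightarrow> real) \<Rightarrow> 'a \<Rightarrow> real" where
  "semigroup_op P t \<phi> x = (\<integral>y. \<phi> y \<partial>P t x)"

definition feller_on :: "(real \<Rightarrow> 'a::polish_space \<Rightarrow> 'a measure) \<Rightarrow> 'a set \<Rightarrow> bool" where
  "feller_on P S \<longleftrightarrow> (\<forall>t\<ge>0. \<forall>\<phi>\<in>Cb UNIV. semigroup_op P t \<phi> \<in> Cb S)"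

text \<open>
  Sections are indexed by all real \<open>s\<close>; those with \<open>s < 0\<close> are determined by
  periodicity. Topological closedness of the sections is not part of this notion.
\<close>

definition poincare_sections ::
    "(real \<Rightarrow> 'a::polish_space \<Rightarrow> 'a measure) \<Rightarrow> real \<Rightarrow> (real \<Rightarrow> 'a set) \<Rightarrow> bool" where
  "poincare_sections P \<tau> L \<longleftrightarrow>
     (\<forall>s. L (s + \<tau>) = L s) \<and>
     (\<forall>s\<ge>0. \<forall>t\<ge>0. \<forall>x\<in>L s. emeasure (P t x) (L (s + t)) = 1)"

definition avg_kernel ::
    "(real \<Rightarrow> 'a::polish_space \<Rightarrow> 'a measure) \<Rightarrow> real \<Rightarrow> nat \<Rightarrow> 'a \<Rightarrow> 'a set \<Rightarrow> real" where
  "avg_kernel P \<tau> N x \<Gamma> = 1 / real N * (\<Sum>k=1..N. measure (P (real k * \<tau>) x) \<Gamma>)"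

definition avg_dual ::
    "(real \<Rightarrow> 'a::polish_space \<Rightarrow> 'a measure) \<Rightarrow> real \<Rightarrow> nat \<Rightarrow> 'a measure \<Rightarrow> 'a measure" where
  "avg_dual P \<tau> N \<nu> =
     measure_of UNIV (sets borel) (\<lambda>\<Gamma>. \<integral>\<^sup>+ x. ennreal (avg_kernel P \<tau> N x \<Gamma>) \<partial>\<nu>)"

definition weakly_converges ::
    "(nat \<Rightarrow> 'a::topological_space measure) \<Rightarrow> 'a measure \<Rightarrow> bool" where
  "weakly_converges \<mu> \<mu>' \<longleftrightarrow>
     (\<forall>\<phi>\<in>Cb UNIV. (\<lambda>i. \<integral>x. \<phi> x \<partial>\<mu> i) \<longlonglongrightarrow> (\<integral>x. \<phi> x \<partial>\<mu>'))"

definition measure_supp :: "'a::topological_space measure \<Rightarrow> 'a set" where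
  "measure_supp \<mu> = {x. \<forall>U. open U \<longrightarrow> x \<in> U \<longrightarrow> emeasure \<mu> U > 0}"

definition push_from ::
    "(real \<Rightarrow> 'a::polish_space \<Rightarrow> 'a measure) \<Rightarrow> 'a set \<Rightarrow> 'a measure \<Rightarrow> real \<Rightarrow> 'a measure" where
  "push_from P S \<mu> t =
     measure_of UNIV (sets borel) (\<lambda>\<Gamma>. \<integral>\<^sup>+ x\<in>S. emeasure (P t x) \<Gamma> \<partial>\<mu>)"

definition section_family ::
    "(real \<Rightarrow> 'a::polish_space \<Rightarrow> 'a measure) \<Rightarrow> real \<Rightarrow> 'a set \<Rightarrow> 'a measure \<Rightarrow> real \<Rightarrow> 'a measure" where
  "section_family P \<tau> S \<mu> s =
     (if 0 \<le> s then push_from P S \<mu> s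
      else push_from P S \<mu> (s + of_int (LEAST k::int. 0 \<le> s + of_int k * \<tau>) * \<tau>))"

definition periodic_measure ::
    "(real \<Rightarrow> 'a::polish_space \<Rightarrow> 'a measure) \<Rightarrow> real \<Rightarrow> (real \<Rightarrow> 'a measure) \<Rightarrow> bool" where
  "periodic_measure P \<tau> \<rho> \<longleftrightarrow>
     (\<forall>s. \<rho> s \<in> borel_probs) \<and>
     (\<forall>s. \<rho> (s + \<tau>) = \<rho> s) \<and>
     (\<forall>s. \<forall>t\<ge>0. \<forall>B\<in>sets borel.
        emeasure (\<rho> (t + s)) B = (\<integral>\<^sup>+ x. emeasure (P t x) B \<partial>\<rho> s))"

end

theory Submission
  imports Defs
begin

text \<open>
  Averaging \<open>\<nu>\<close> over \<open>k = 1, \<dots>, N\<close> and then applying \<open>P (j * \<tau>)\<close> changes integrals of bounded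
  functions by \<open>O(1 / N)\<close>. All averages live on the closed set \<open>L 0\<close>, hence so does the weak limit
  \<open>\<rho>0\<close>. The function \<open>P (j * \<tau>) \<phi>\<close> is continuous only on \<open>L 0\<close>, but its Tietze extension is a
  legitimate test function for weak convergence, so \<open>\<rho>0\<close> is invariant under \<open>P (j * \<tau>)\<close>, including
  \<open>j = 0\<close>, where \<open>P 0\<close> need not be the identity. Pushing \<open>\<rho>0\<close> forward along the semigroup then
  gives a periodic family.
\<close>

section \<open>Borel probability measures\<close>

lemma borel_probsD:
  assumes "M \<in> borel_probs"
  shows "sets M = sets borel" "space M = UNIV" "prob_space M"
  using assms sets_eq_imp_space_eq[of M borel] by (auto simp: space_prob_algebra)

text \<open>\<open>avg_dual\<close> and \<open>push_from\<close> are raw \<open>measure_of\<close>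
  terms, whose values are the intended ones only for a countably additive set function. Identifying
  the set function with an existing measure supplies additivity at no cost.\<close>

lemma measure_of_borel_eqI:
  fixes M :: "'a::topological_space measure"
  assumes sets: "sets M = sets borel"
    and eq: "\<And>B. B \<in> sets borel \<Longrightarrow> f B = emeasure M B"
  shows "measure_of UNIV (sets borel) f = M"
proof -
  have sp: "space M = UNIV"
    using sets_eq_imp_space_eq[OF sets] by simp
  have "measure_of UNIV (sets borel) f = measure_of UNIV (sets borel) (emeasure M)"
    using eq sets.sigma_sets_eq[of borel] by (intro measure_of_eq) auto
  then show ?thesis
    using measure_of_of_measure[of M] by (simp add: sets sp)
qed

lemma borel_prob_emeasure_eq_1_iff:
  assumes "M \<in> borel_probs" "closed S"
  shows "emeasure M S = 1 \<longleftrightarrow> (AE x in M. x \<in> S)"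
proof -
  interpret prob_space M using borel_probsD[OF assms(1)] by simp
  have "S \<in> sets M"
    using assms borel_probsD[OF assms(1)] by simp
  then show ?thesis
    using emeasure_eq_1_AE AE_in_set_eq_1 by (auto simp: emeasure_eq_measure)
qed

text \<open>The complement of the support is the union of all null open sets. This union may be
  uncountable, but by Lindelof a countable subfamily already covers it, so it is null.\<close>

lemma AE_in_measure_supp:
  fixes M :: "'a::second_countable_topology measure"
  assumes "sets M = sets borel"
  shows "AE x in M. x \<in> measure_supp M"
proof -
  let ?F = "{U. open U \<and> emeasure M U = 0}"
  obtain F where F: "F \<subseteq> ?F" "countable F" "\<Union>F = \<Union>?F"
    using Lindelof[of ?F] by blast
  have "U \<in> null_sets M" if "U \<in> F" for U
    using F(1) assms that by (intro null_setsI) auto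
  then have "(\<Union>U\<in>F. U) \<in> null_sets M"
    using F(2) by (intro null_sets_UN')
  then have "AE x in M. x \<notin> (\<Union>U\<in>F. U)"
    by (rule AE_not_in)
  moreover have "x \<in> measure_supp M" if "x \<notin> (\<Union>U\<in>F. U)" for x
  proof -
    from that F have "x \<notin> \<Union>?F"
      by auto
    then show ?thesis
      by (auto simp: measure_supp_def zero_less_iff_neq_zero)
  qed
  ultimately show ?thesis
    by auto
qed

text \<open>One direction holds because almost every point lies in the support. For the other,
  closedness makes \<open>- S\<close> an open null set, hence a neighbourhood that excludes each of
  its points from the support.\<close>

lemma measure_supp_subset_iff:
  fixes M :: "'a::second_countable_topology measure"
  assumes M: "M \<in> borel_probs" and S: "closed S"
  shows "measure_supp M \<subseteq> S \<longleftrightarrow> emeasure M S = 1"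
proof
  assume "measure_supp M \<subseteq> S"
  then show "emeasure M S = 1"
    using AE_in_measure_supp[OF borel_probsD(1)[OF M]] borel_prob_emeasure_eq_1_iff[OF M S]
    by auto
next
  assume "emeasure M S = 1"
  then have "AE x in M. x \<notin> - S"
    using borel_prob_emeasure_eq_1_iff[OF M S] by auto
  then have "emeasure M (- S) = 0"
    using S borel_probsD[OF M] by (subst (asm) AE_iff_measurable[of "- S"]) auto
  then show "measure_supp M \<subseteq> S"
    using S by (force simp: measure_supp_def open_Compl)
qed

section \<open>Bounded continuous test functions and weak limits\<close>

lemma Cb_measurable: "\<phi> \<in> Cb UNIV \<Longrightarrow> \<phi> \<in> borel_measurable borel"
  by (auto simp: Cb_def intro: borel_measurable_continuous_onI)

lemma Cb_bound:
  assumes "\<phi> \<in> Cb S"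
  obtains C where "0 \<le> C" "\<And>x. x \<in> S \<Longrightarrow> \<bar>\<phi> x\<bar> \<le> C"
proof -
  from assms obtain C where "\<And>x. x \<in> S \<Longrightarrow> \<bar>\<phi> x\<bar> \<le> C"
    by (auto simp: Cb_def bounded_iff)
  then show ?thesis
    by (intro that[of "max C 0"]) (auto intro: max.coboundedI1)
qed

lemma abs_integral_le:
  assumes M: "M \<in> borel_probs" and \<phi>: "\<phi> \<in> Cb UNIV" and C: "\<And>x. \<bar>\<phi> x\<bar> \<le> C"
  shows "\<bar>\<integral>x. \<phi> x \<partial>M\<bar> \<le> C"
proof -
  interpret prob_space M
    using borel_probsD[OF M] by simp
  have "integrable M \<phi>"
    using Cb_measurable[OF \<phi>] borel_probsD(1)[OF M] C
    by (intro integrable_const_bound[of _ C]) (auto cong: measurable_cong_sets)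
  then show ?thesis
    using C integral_le_const[of \<phi> C] integral_ge_const[of \<phi> "- C"]
    by (auto simp: abs_le_iff minus_le_iff)
qed

text \<open>These truncated distances serve twice: with \<open>c\<close> tending to infinity they
  approximate the indicator of the open set \<open>- S\<close>, and with \<open>c = 1\<close> they
  detect membership in a closed \<open>S\<close>.\<close>

lemma min_infdist_in_Cb:
  fixes S :: "'a::metric_space set"
  assumes "0 \<le> c"
  shows "(\<lambda>x. min 1 (c * infdist x S)) \<in> Cb UNIV"
proof -
  have "\<bar>min 1 (c * infdist x S)\<bar> \<le> 1" for x
    using mult_nonneg_nonneg[OF assms infdist_nonneg[of x S]] by linarith
  then show ?thesis
    by (auto simp: Cb_def bounded_iff intro!: continuous_intros exI[of _ 1])
qed

text \<open>The indicator of an open set is a pointwise limit of truncated distances to its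
  complement. Dominated convergence therefore gives agreement on open sets, an intersection-stable
  generator of the Borel sets.\<close>

lemma borel_prob_eqI:
  fixes M M' :: "'a::metric_space measure"
  assumes M: "M \<in> borel_probs" "M' \<in> borel_probs"
    and eq: "\<And>\<phi>. \<phi> \<in> Cb UNIV \<Longrightarrow> (\<integral>x. \<phi> x \<partial>M) = (\<integral>x. \<phi> x \<partial>M')"
  shows "M = M'"
proof (rule measure_eqI_generator_eq)
  show "Int_stable {U::'a set. open U}"
    by (auto simp: Int_stable_def)
  show "sets M = sigma_sets UNIV {U. open U}" "sets M' = sigma_sets UNIV {U. open U}"
    using borel_probsD[OF M(1)] borel_probsD[OF M(2)] by (auto simp: borel_def)
  show "range (\<lambda>_. UNIV) \<subseteq> {U::'a set. open U}"
    by auto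
  have UNIV: "emeasure K UNIV = 1" if "K \<in> borel_probs" for K :: "'a measure"
    using borel_probsD[OF that] prob_space.emeasure_space_1[of K] by simp
  then show "emeasure M UNIV \<noteq> \<infinity>"
    using M by simp
  fix U :: "'a set" assume "U \<in> {U. open U}"
  then have U: "open U" by simp
  show "emeasure M U = emeasure M' U"
  \<comment> \<open>The whole space is separated because \<open>infdist\<close> to the empty set is
    0 by convention, so the approximating functions would all vanish there.\<close>
  proof (cases "U = UNIV")
    case True
    then show ?thesis using UNIV M by simp
  next
    case False
    define f where "f n x = min 1 (real n * infdist x (- U))" for n x
    have f_Cb: "f n \<in> Cb UNIV" for n
      unfolding f_def by (intro min_infdist_in_Cb) simp
    have lim: "(\<lambda>n. f n x) \<longlonglongrightarrow> indicator U x" for x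
    proof (cases "x \<in> U")
      case True
      then have pos: "infdist x (- U) > 0"
        using U False infdist_pos_not_in_closed[of "- U" x] by auto
      obtain n0 where n0: "1 < real n0 * infdist x (- U)"
        using reals_Archimedean3[OF pos] by blast
      have "f n x = 1" if "n \<ge> n0" for n
      proof -
        have "real n0 * infdist x (- U) \<le> real n * infdist x (- U)"
          using that pos by (intro mult_right_mono) auto
        with n0 show ?thesis by (simp add: f_def)
      qed
      then have "\<forall>\<^sub>F n in sequentially. f n x = indicator U x"
        using True by (auto simp: eventually_sequentially)
      then show ?thesis
        by (rule tendsto_eventually)
    next
      case False
      then show ?thesis by (simp add: f_def)
    qed
    have conv: "(\<lambda>n. \<integral>x. f n x \<partial>K) \<longlonglongrightarrow> measure K U" if K: "K \<in> borel_probs" for K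
    proof -
      interpret prob_space K using borel_probsD[OF K] by simp
      have [measurable_cong]: "sets K = sets borel" using borel_probsD[OF K] by simp
      have [measurable]: "f n \<in> borel_measurable K" "U \<in> sets K" for n
        using Cb_measurable[OF f_Cb[of n]] U borel_probsD(1)[OF K]
        by (auto cong: measurable_cong_sets)
      have "(\<lambda>n. \<integral>x. f n x \<partial>K) \<longlonglongrightarrow> (\<integral>x. indicator U x \<partial>K)"
      proof (rule integral_dominated_convergence[where w = "\<lambda>_. 1"])
        have "\<bar>f n x\<bar> \<le> 1" for n x
          unfolding f_def using mult_nonneg_nonneg[OF of_nat_0_le_iff[of n] infdist_nonneg[of x "- U"]]
          by linarith
        then show "AE x in K. norm (f n x) \<le> 1" for n
          by simp
      qed (use lim in auto)
      then show ?thesis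
        using borel_probsD[OF K] by simp
    qed
    have "measure M U = measure M' U"
      using LIMSEQ_unique[OF conv[OF M(1)]] conv[OF M(2)] eq[OF f_Cb] by simp
    then show ?thesis
      using borel_probsD(3)[OF M(1)] borel_probsD(3)[OF M(2)]
      by (simp add: finite_measure.emeasure_eq_measure prob_space_def)
  qed
qed auto

text \<open>The truncated distance to \<open>S\<close> is a test function vanishing exactly on
  \<open>S\<close>. Its integrals are eventually 0, hence so is the one against the limit, and a
  nonnegative function with integral 0 vanishes almost everywhere. The hypothesis is only eventual
  because the average over \<open>N = 0\<close> terms is not a probability measure.\<close>

lemma weak_limit_closed:
  fixes S :: "'a::metric_space set"
  assumes lim: "weakly_converges \<mu> \<rho>" and \<rho>: "\<rho> \<in> borel_probs" and S: "closed S"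
    and ev: "\<forall>\<^sub>F i in sequentially. \<mu> i \<in> borel_probs \<and> emeasure (\<mu> i) S = 1"
  shows "emeasure \<rho> S = 1"
proof -
  from ev obtain i where i: "emeasure (\<mu> i) S = 1"
    unfolding eventually_sequentially by blast
  \<comment> \<open>Nonemptiness excludes the convention \<open>infdist x {} = 0\<close>, under
    which a zero distance would not imply membership.\<close>
  then have ne: "S \<noteq> {}" by auto
  define f where "f x = min 1 (1 * infdist x S)" for x
  have f: "f \<in> Cb UNIV"
    unfolding f_def by (rule min_infdist_in_Cb) simp
  have f_0: "f x = 0 \<longleftrightarrow> x \<in> S" and f_ge: "f x \<ge> 0" and f_le: "f x \<le> 1" for x
    using in_closed_iff_infdist_zero[OF S ne, of x] by (auto simp: f_def min_def infdist_nonneg)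
  interpret prob_space \<rho> using borel_probsD[OF \<rho>] by simp
  have meas: "f \<in> borel_measurable K" if "K \<in> borel_probs" for K
    using Cb_measurable[OF f] borel_probsD(1)[OF that] by (auto cong: measurable_cong_sets)
  have "\<forall>\<^sub>F i in sequentially. (\<integral>x. f x \<partial>\<mu> i) = 0"
    using ev
  proof eventually_elim
    case (elim i)
    then have "AE x in \<mu> i. f x = 0"
      using borel_prob_emeasure_eq_1_iff[OF _ S, of "\<mu> i"] f_0 by auto
    then show ?case
      by (rule integral_eq_zero_AE)
  qed
  then have "(\<lambda>i. \<integral>x. f x \<partial>\<mu> i) \<longlonglongrightarrow> 0"
    by (rule tendsto_eventually)
  then have "(\<integral>x. f x \<partial>\<rho>) = 0"
    using lim f LIMSEQ_unique unfolding weakly_converges_def by blast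
  moreover have "integrable \<rho> f"
    using meas[OF \<rho>] f_ge f_le by (intro integrable_const_bound[of _ 1]) auto
  ultimately have "AE x in \<rho>. f x = 0"
    using integral_nonneg_eq_0_iff_AE[of \<rho> f] f_ge by simp
  then show ?thesis
    using borel_prob_emeasure_eq_1_iff[OF \<rho> S] f_0 by simp
qed

text \<open>Each unit shift of the summation window trades \<open>a (Suc j)\<close> for
  \<open>a (n + Suc j)\<close> and so costs at most \<open>2 * C\<close>. The total cost after
  \<open>j\<close> shifts does not depend on \<open>n\<close>, and division by \<open>n\<close>
  kills it.\<close>

lemma cesaro_shift:
  fixes a :: "nat \<Rightarrow> real"
  assumes "\<And>k. \<bar>a k\<bar> \<le> C"
  shows "(\<lambda>n. (\<Sum>k=1..n. a (k + j)) / real n - (\<Sum>k=1..n. a k) / real n) \<longlonglongrightarrow> 0"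
proof -
  have bound: "\<bar>(\<Sum>k=1..n. a (k + j)) - (\<Sum>k=1..n. a k)\<bar> \<le> 2 * real j * C" for n
  proof (induction j)
    case (Suc j)
    have "(\<Sum>k=1..n. a (k + Suc j)) - (\<Sum>k=1..n. a (k + j)) = a (n + Suc j) - a (Suc j)"
      by (induction n) auto
    moreover have "\<bar>a (n + Suc j)\<bar> \<le> C" "\<bar>a (Suc j)\<bar> \<le> C"
      using assms by blast+
    ultimately show ?case
      using Suc by (simp add: algebra_simps)
  qed simp
  show ?thesis
  proof (rule Lim_null_comparison)
    show "(\<lambda>n. (2 * real j * C) / real n) \<longlonglongrightarrow> 0"
      by (rule lim_const_over_n)
    show "\<forall>\<^sub>F n in sequentially. norm ((\<Sum>k=1..n. a (k + j)) / real n - (\<Sum>k=1..n. a k) / real n)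
        \<le> (2 * real j * C) / real n"
      using bound by (intro always_eventually allI)
        (simp add: diff_divide_distrib[symmetric] divide_right_mono)
  qed
qed

section \<open>The semigroup acting on measures\<close>

lemma borel_probs_bind:
  assumes "\<mu> \<in> borel_probs" "K \<in> borel \<rightarrow>\<^sub>M prob_algebra borel"
  shows "\<mu> \<bind> K \<in> borel_probs"
  using sets_bind'[OF assms] prob_space_bind'[OF assms] by (simp add: space_prob_algebra)

lemma integral_bind_prob:
  fixes \<phi> :: "'b \<Rightarrow> real"
  assumes K: "K \<in> M \<rightarrow>\<^sub>M prob_algebra N" and M: "prob_space M"
    and \<phi>: "\<phi> \<in> borel_measurable N" and C: "\<And>x. \<bar>\<phi> x\<bar> \<le> C"
  shows "(\<integral>y. \<phi> y \<partial>(M \<bind> K)) = (\<integral>x. \<integral>y. \<phi> y \<partial>K x \<partial>M)"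
proof (rule integral_bind[where K = N and B = C and B' = 1])
  show "K \<in> M \<rightarrow>\<^sub>M subprob_algebra N"
    using K by (rule measurable_prob_algebraD)
  show "finite_measure M"
    using M by (simp add: prob_space_def)
  show "AE x in M. emeasure (K x) (space (K x)) \<le> ennreal 1"
    using measurable_space[OF K]
    by (auto simp: space_prob_algebra prob_space.emeasure_space_1)
qed (use \<phi> C in auto)

text \<open>The source space \<open>A\<close> is arbitrary so that the lemma covers both the
  transition kernels on \<open>borel\<close> and the discrete kernel that sends the number of
  periods to a law.\<close>

lemma prob_kernel_AE_bind:
  assumes M: "M \<in> space (prob_algebra A)" and K: "K \<in> A \<rightarrow>\<^sub>M prob_algebra borel" and S: "closed S"
    and AE: "AE x in M. emeasure (K x) S = 1"
  shows "emeasure (M \<bind> K) S = 1"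
proof -
  have "emeasure (M \<bind> K) S = (\<integral>\<^sup>+x. emeasure (K x) S \<partial>M)"
    using M K S by (intro emeasure_bind_prob_algebra) auto
  also have "\<dots> = (\<integral>\<^sup>+x. 1 \<partial>M)"
    using AE by (rule nn_integral_cong_AE)
  also have "\<dots> = 1"
    using M by (simp add: space_prob_algebra prob_space.emeasure_space_1)
  finally show ?thesis .
qed

lemma markov_semigroup_measurable:
  "markov_semigroup P \<Longrightarrow> 0 \<le> t \<Longrightarrow> P t \<in> borel \<rightarrow>\<^sub>M prob_algebra borel"
  by (simp add: markov_semigroup_def)

text \<open>Chapman-Kolmogorov is recast as Kleisli composition in the Giry monad, so that
  associativity of bind can replace manipulations of iterated integrals.\<close>

lemma markov_semigroup_bind:
  assumes P: "markov_semigroup P" and s: "0 \<le> s" and t: "0 \<le> t"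
  shows "P s x \<bind> P t = P (s + t) x"
proof (rule measure_eqI)
  note K = markov_semigroup_measurable[OF P]
  have Px: "P r x \<in> borel_probs" if "0 \<le> r" for r
    using measurable_space[OF K[OF that], of x] by simp
  show sets: "sets (P s x \<bind> P t) = sets (P (s + t) x)"
    using borel_probsD(1)[OF borel_probs_bind[OF Px[OF s] K[OF t]]] borel_probsD(1)[OF Px] s t
    by simp
  fix B assume "B \<in> sets (P s x \<bind> P t)"
  then have B: "B \<in> sets borel"
    using borel_probsD(1)[OF borel_probs_bind[OF Px[OF s] K[OF t]]] by simp
  show "emeasure (P s x \<bind> P t) B = emeasure (P (s + t) x) B"
    using emeasure_bind_prob_algebra[OF Px[OF s] K[OF t] B] P s t B
    by (simp add: markov_semigroup_def)
qed

lemma markov_semigroup_bind_bind: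
  assumes P: "markov_semigroup P" and s: "0 \<le> s" and t: "0 \<le> t" and \<mu>: "\<mu> \<in> borel_probs"
  shows "(\<mu> \<bind> P s) \<bind> P t = \<mu> \<bind> P (s + t)"
proof -
  have K: "P r \<in> \<mu> \<rightarrow>\<^sub>M subprob_algebra borel" "P r \<in> borel \<rightarrow>\<^sub>M subprob_algebra borel" if "0 \<le> r" for r
    using measurable_prob_algebraD[OF markov_semigroup_measurable[OF P that]] borel_probsD(1)[OF \<mu>]
    by (auto cong: measurable_cong_sets)
  have "(\<mu> \<bind> P s) \<bind> P t = \<mu> \<bind> (\<lambda>x. P s x \<bind> P t)"
    using K s t by (intro bind_assoc)
  then show ?thesis
    by (simp add: markov_semigroup_bind[OF P s t])
qed

text \<open>This is the duality between the semigroup acting on functions and on measures. It moves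
  the time shift from the integrand to the law.\<close>

lemma integral_semigroup_op:
  assumes P: "markov_semigroup P" and t: "0 \<le> t" and \<mu>: "\<mu> \<in> borel_probs" and \<phi>: "\<phi> \<in> Cb UNIV"
  shows "(\<integral>x. semigroup_op P t \<phi> x \<partial>\<mu>) = (\<integral>y. \<phi> y \<partial>(\<mu> \<bind> P t))"
proof -
  obtain C where C: "\<And>x. \<bar>\<phi> x\<bar> \<le> C"
    using Cb_bound[OF \<phi>] by auto
  have "P t \<in> \<mu> \<rightarrow>\<^sub>M prob_algebra borel"
    using markov_semigroup_measurable[OF P t] borel_probsD(1)[OF \<mu>]
    by (auto cong: measurable_cong_sets)
  from integral_bind_prob[OF this borel_probsD(3)[OF \<mu>] Cb_measurable[OF \<phi>] C]
  show ?thesis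
    by (simp add: semigroup_op_def)
qed

lemma semigroup_op_measurable:
  assumes P: "markov_semigroup P" and t: "0 \<le> t" and \<phi>: "\<phi> \<in> Cb UNIV"
  shows "semigroup_op P t \<phi> \<in> borel_measurable borel"
  unfolding semigroup_op_def
  using measurable_compose[OF measurable_prob_algebraD[OF markov_semigroup_measurable[OF P t]]
      integral_measurable_subprob_algebra[OF Cb_measurable[OF \<phi>]]] by simp

text \<open>The restriction of the integral to \<open>S\<close> is invisible to a measure that gives
  \<open>S\<close> full mass.\<close>

lemma push_from_eq_bind:
  assumes P: "markov_semigroup P" and t: "0 \<le> t" and \<mu>: "\<mu> \<in> borel_probs"
    and S: "closed S" "emeasure \<mu> S = 1"
  shows "push_from P S \<mu> t = \<mu> \<bind> P t"
  unfolding push_from_def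
proof (rule measure_of_borel_eqI)
  note K = markov_semigroup_measurable[OF P t]
  show "sets (\<mu> \<bind> P t) = sets borel"
    by (rule sets_bind'[OF \<mu> K])
  fix B :: "'a set" assume B: "B \<in> sets borel"
  have "AE x in \<mu>. x \<in> S"
    using borel_prob_emeasure_eq_1_iff[OF \<mu> S(1)] S(2) by simp
  then have "(\<integral>\<^sup>+x\<in>S. emeasure (P t x) B \<partial>\<mu>) = (\<integral>\<^sup>+x. emeasure (P t x) B \<partial>\<mu>)"
    by (intro nn_integral_cong_AE) (auto simp: indicator_def)
  then show "(\<integral>\<^sup>+x\<in>S. emeasure (P t x) B \<partial>\<mu>) = emeasure (\<mu> \<bind> P t) B"
    using emeasure_bind_prob_algebra[OF \<mu> K B] by simp
qed

section \<open>Averages along the period\<close>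

lemma avg_steps_measurable:
  assumes "markov_semigroup P" "0 < \<tau>" "\<nu> \<in> borel_probs"
  shows "(\<lambda>k. \<nu> \<bind> P (real k * \<tau>)) \<in> count_space UNIV \<rightarrow>\<^sub>M prob_algebra borel"
  using borel_probs_bind[OF assms(3) markov_semigroup_measurable[OF assms(1)]] assms(2) by simp

text \<open>The average is a mixture: draw \<open>k\<close> uniformly from \<open>{1..n}\<close>,
  then run the process for \<open>k\<close> periods from \<nu>. Positivity of \<open>n\<close> makes
  the uniform distribution meaningful, and the bind lemmas then apply to averages as well.\<close>

lemma avg_dual_eq_bind:
  assumes P: "markov_semigroup P" and \<tau>: "0 < \<tau>" and \<nu>: "\<nu> \<in> borel_probs" and n: "0 < n"
  shows "avg_dual P \<tau> n \<nu> = measure_pmf (pmf_of_set {1..n}) \<bind> (\<lambda>k. \<nu> \<bind> P (real k * \<tau>))"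
  unfolding avg_dual_def
proof (rule measure_of_borel_eqI)
  let ?p = "measure_pmf (pmf_of_set {1..n})" and ?M = "\<lambda>k. \<nu> \<bind> P (real k * \<tau>)"
  have p: "?p \<in> space (prob_algebra (count_space UNIV))"
    by (simp add: space_prob_algebra prob_space_measure_pmf)
  note M = avg_steps_measurable[OF P \<tau> \<nu>]
  have K: "P (real k * \<tau>) \<in> borel \<rightarrow>\<^sub>M prob_algebra borel" for k
    using markov_semigroup_measurable[OF P] \<tau> by simp
  show "sets (?p \<bind> ?M) = sets borel"
    by (rule sets_bind'[OF p M])
  fix B :: "'a set" assume B: "B \<in> sets borel"
  have [measurable_cong]: "sets \<nu> = sets borel"
    using borel_probsD[OF \<nu>] by simp
  have [measurable]: "(\<lambda>x. emeasure (P (real k * \<tau>) x) B) \<in> borel_measurable borel" for k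
    using measurable_emeasure_kernel[OF measurable_prob_algebraD[OF K] B] .
  have "ennreal (avg_kernel P \<tau> n x B) = (\<Sum>k=1..n. emeasure (P (real k * \<tau>) x) B) / of_nat n" for x
  proof -
    have "emeasure (P (real k * \<tau>) x) B = ennreal (measure (P (real k * \<tau>) x) B)" for k
      using measurable_space[OF K, of x]
      by (auto simp: space_prob_algebra prob_space_def finite_measure.emeasure_eq_measure)
    then show ?thesis
      using n by (simp add: avg_kernel_def sum_ennreal divide_ennreal sum_nonneg
          ennreal_of_nat_eq_real_of_nat)
  qed
  then have "(\<integral>\<^sup>+x. ennreal (avg_kernel P \<tau> n x B) \<partial>\<nu>)
      = (\<Sum>k=1..n. \<integral>\<^sup>+x. emeasure (P (real k * \<tau>) x) B \<partial>\<nu>) / of_nat n"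
    by (simp add: nn_integral_divide nn_integral_sum)
  also have "\<dots> = (\<Sum>k=1..n. emeasure (?M k) B) / of_nat n"
    using emeasure_bind_prob_algebra[OF \<nu> K B] by simp
  also have "\<dots> = (\<integral>\<^sup>+k. emeasure (?M k) B \<partial>?p)"
    using n by (subst nn_integral_pmf_of_set) (auto simp: ennreal_of_nat_eq_real_of_nat)
  also have "\<dots> = emeasure (?p \<bind> ?M) B"
    by (rule emeasure_bind_prob_algebra[OF p M B, symmetric])
  finally show "(\<integral>\<^sup>+x. ennreal (avg_kernel P \<tau> n x B) \<partial>\<nu>) = emeasure (?p \<bind> ?M) B" .
qed

lemma avg_dual_borel_probs:
  assumes "markov_semigroup P" "0 < \<tau>" "\<nu> \<in> borel_probs" "0 < n"
  shows "avg_dual P \<tau> n \<nu> \<in> borel_probs"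
proof -
  have p: "measure_pmf (pmf_of_set {1..n}) \<in> space (prob_algebra (count_space UNIV))"
    by (simp add: space_prob_algebra prob_space_measure_pmf)
  note M = avg_steps_measurable[OF assms(1-3)]
  show ?thesis
    unfolding avg_dual_eq_bind[OF assms] space_prob_algebra
    using sets_bind'[OF p M] prob_space_bind'[OF p M] by blast
qed

lemma integral_avg_dual:
  assumes "markov_semigroup P" "0 < \<tau>" "\<nu> \<in> borel_probs" "0 < n"
    and \<phi>: "\<phi> \<in> borel_measurable borel" "\<And>x. \<bar>\<phi> x\<bar> \<le> C"
  shows "(\<integral>x. \<phi> x \<partial>avg_dual P \<tau> n \<nu>) = (\<Sum>k=1..n. \<integral>x. \<phi> x \<partial>(\<nu> \<bind> P (real k * \<tau>))) / real n"
proof -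
  have M: "(\<lambda>k. \<nu> \<bind> P (real k * \<tau>)) \<in> measure_pmf (pmf_of_set {1..n}) \<rightarrow>\<^sub>M prob_algebra borel"
    using avg_steps_measurable[OF assms(1-3)] by (auto cong: measurable_cong_sets)
  show ?thesis
    using assms integral_bind_prob[OF M prob_space_measure_pmf \<phi>]
    by (simp add: avg_dual_eq_bind integral_pmf_of_set)
qed

text \<open>Started in \<open>L 0\<close>, the process is almost surely in
  \<open>L (k * \<tau>)\<close>, which is \<open>L 0\<close> again, after \<open>k\<close> periods.
  Every component of the mixture thus lives on \<open>L 0\<close>.\<close>

lemma avg_dual_section:
  assumes P: "markov_semigroup P" and \<tau>: "0 < \<tau>" and \<nu>: "\<nu> \<in> borel_probs" and n: "0 < n"
    and L: "poincare_sections P \<tau> L" "closed (L 0)" and \<nu>L: "emeasure \<nu> (L 0) = 1"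
  shows "emeasure (avg_dual P \<tau> n \<nu>) (L 0) = 1"
proof -
  have per: "L (real k * \<tau>) = L 0" for k
  proof (induction k)
    case (Suc k)
    have "L (real (Suc k) * \<tau>) = L (real k * \<tau> + \<tau>)"
      by (simp add: algebra_simps)
    with Suc L show ?case
      by (simp add: poincare_sections_def)
  qed simp
  have "emeasure (\<nu> \<bind> P (real k * \<tau>)) (L 0) = 1" for k
  proof (rule prob_kernel_AE_bind[OF \<nu> markov_semigroup_measurable[OF P] L(2)])
    have "emeasure (P (real k * \<tau>) x) (L 0) = 1" if "x \<in> L 0" for x
    proof -
      have "emeasure (P (real k * \<tau>) x) (L (0 + real k * \<tau>)) = 1"
        using L(1) that \<tau> unfolding poincare_sections_def by (meson mult_nonneg_nonneg
            less_imp_le of_nat_0_le_iff order_refl)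
      then show ?thesis
        by (simp add: per)
    qed
    then show "AE x in \<nu>. emeasure (P (real k * \<tau>) x) (L 0) = 1"
      using borel_prob_emeasure_eq_1_iff[OF \<nu> L(2)] \<nu>L by auto
  qed (use \<tau> in simp)
  then show ?thesis
    unfolding avg_dual_eq_bind[OF P \<tau> \<nu> n]
    by (intro prob_kernel_AE_bind[OF _ avg_steps_measurable[OF P \<tau> \<nu>] L(2)])
      (auto simp: space_prob_algebra prob_space_measure_pmf)
qed

section \<open>Tietze extension and invariance of the weak limit\<close>

lemma Cb_extension:
  fixes f :: "'a::{metric_space,second_countable_topology} \<Rightarrow> real"
  assumes f: "f \<in> Cb S" and S: "closed S"
  obtains g where "g \<in> Cb UNIV" "\<And>x. x \<in> S \<Longrightarrow> g x = f x"
proof -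
  obtain C where C: "0 \<le> C" "\<And>x. x \<in> S \<Longrightarrow> \<bar>f x\<bar> \<le> C"
    using Cb_bound[OF f] by blast
  have "continuous_on S f" "closedin (top_of_set UNIV) S" "\<And>x. x \<in> S \<Longrightarrow> norm (f x) \<le> C"
    using f S C by (auto simp: Cb_def)
  then obtain g where "continuous_on UNIV g" "\<And>x. x \<in> S \<Longrightarrow> g x = f x" "\<And>x. x \<in> UNIV \<Longrightarrow> norm (g x) \<le> C"
    using Tietze[of S f UNIV C] C(1) by metis
  then show ?thesis
    by (intro that[of g]) (auto simp: Cb_def bounded_iff)
qed

lemma weak_limit_invariant:
  assumes P: "markov_semigroup P" and \<tau>: "0 < \<tau>" and \<nu>: "\<nu> \<in> borel_probs"
    and S: "closed S" and feller: "feller_on P S" and N: "strict_mono N"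
    and avg: "\<And>n. 0 < n \<Longrightarrow> emeasure (avg_dual P \<tau> n \<nu>) S = 1"
    and \<rho>: "\<rho> \<in> borel_probs" "emeasure \<rho> S = 1"
    and lim: "weakly_converges (\<lambda>i. avg_dual P \<tau> (N i) \<nu>) \<rho>"
  shows "\<rho> \<bind> P (real j * \<tau>) = \<rho>"
proof (rule borel_prob_eqI)
  let ?t = "real j * \<tau>"
  have t: "0 \<le> ?t" using \<tau> by simp
  note K = markov_semigroup_measurable[OF P t]
  show "\<rho> \<bind> P ?t \<in> borel_probs"
    by (rule borel_probs_bind[OF \<rho>(1) K])
  show "\<rho> \<in> borel_probs" by fact
  fix \<phi> :: "'a \<Rightarrow> real" assume \<phi>: "\<phi> \<in> Cb UNIV"
  obtain C where C: "0 \<le> C" "\<And>x. \<bar>\<phi> x\<bar> \<le> C"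
    using Cb_bound[OF \<phi>] by auto
  have "semigroup_op P ?t \<phi> \<in> Cb S"
    using feller t \<phi> by (simp add: feller_on_def)
  then obtain g where g: "g \<in> Cb UNIV" and g_eq: "\<And>x. x \<in> S \<Longrightarrow> g x = semigroup_op P ?t \<phi> x"
    using Cb_extension S by blast
  \<comment> \<open>A measure carried by \<open>S\<close> cannot distinguish \<open>g\<close> from
    the transported function \<open>semigroup_op P ?t \<phi>\<close>. This is applied both to the
    averages and to the limit.\<close>
  have g_int: "(\<integral>x. g x \<partial>\<mu>) = (\<integral>x. \<phi> x \<partial>(\<mu> \<bind> P ?t))"
    if \<mu>: "\<mu> \<in> borel_probs" "emeasure \<mu> S = 1" for \<mu>
  proof -
    have "(\<integral>x. g x \<partial>\<mu>) = (\<integral>x. semigroup_op P ?t \<phi> x \<partial>\<mu>)"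
    proof (rule integral_cong_AE)
      show "AE x in \<mu>. g x = semigroup_op P ?t \<phi> x"
        using borel_prob_emeasure_eq_1_iff[OF \<mu>(1) S] \<mu>(2) g_eq by auto
    qed (use Cb_measurable[OF g] semigroup_op_measurable[OF P t \<phi>] borel_probsD(1)[OF \<mu>(1)]
        in \<open>auto cong: measurable_cong_sets\<close>)
    then show ?thesis
      using integral_semigroup_op[OF P t \<mu>(1) \<phi>] by simp
  qed
  define a where "a k = (\<integral>x. \<phi> x \<partial>(\<nu> \<bind> P (real k * \<tau>)))" for k
  have M: "\<nu> \<bind> P (real k * \<tau>) \<in> borel_probs" for k
    using borel_probs_bind[OF \<nu> markov_semigroup_measurable[OF P]] \<tau> by simp
  have a_bound: "\<bar>a k\<bar> \<le> C" for k
    unfolding a_def by (rule abs_integral_le[OF M \<phi> C(2)])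
  have avg_\<phi>: "(\<integral>x. \<phi> x \<partial>avg_dual P \<tau> n \<nu>) = (\<Sum>k=1..n. a k) / real n" if "0 < n" for n
    unfolding a_def by (rule integral_avg_dual[OF P \<tau> \<nu> that Cb_measurable[OF \<phi>] C(2)])
  have avg_g: "(\<integral>x. g x \<partial>avg_dual P \<tau> n \<nu>) = (\<Sum>k=1..n. a (k + j)) / real n" if n: "0 < n" for n
  proof -
    let ?h = "semigroup_op P ?t \<phi>"
    have "P ?t x \<in> borel_probs" for x
      using measurable_space[OF K, of x] by simp
    then have h_bound: "\<bar>?h x\<bar> \<le> C" for x
      unfolding semigroup_op_def by (rule abs_integral_le[OF _ \<phi> C(2)])
    have A: "avg_dual P \<tau> n \<nu> \<in> borel_probs"
      by (rule avg_dual_borel_probs[OF P \<tau> \<nu> n])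
    have "(\<integral>x. g x \<partial>avg_dual P \<tau> n \<nu>) = (\<integral>x. ?h x \<partial>avg_dual P \<tau> n \<nu>)"
      using g_int[OF A avg[OF n]] integral_semigroup_op[OF P t A \<phi>] by simp
    also have "\<dots> = (\<Sum>k=1..n. \<integral>x. ?h x \<partial>(\<nu> \<bind> P (real k * \<tau>))) / real n"
      by (rule integral_avg_dual[OF P \<tau> \<nu> n semigroup_op_measurable[OF P t \<phi>] h_bound])
    \<comment> \<open>Transporting \<phi> by \<open>j\<close> periods amounts to running the law for
      \<open>j\<close> more periods, so the average of \<open>g\<close> is the average of
      \<open>a\<close> over a window shifted by \<open>j\<close>.\<close>
    also have "(\<lambda>k. \<integral>x. ?h x \<partial>(\<nu> \<bind> P (real k * \<tau>))) = (\<lambda>k. a (k + j))"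
      using integral_semigroup_op[OF P t M \<phi>]
        markov_semigroup_bind_bind[OF P _ t \<nu>, of "real _ * \<tau>"] \<tau>
      by (simp add: a_def algebra_simps)
    finally show ?thesis .
  qed
  \<comment> \<open>Strict monotonicity allows \<open>N 0 = 0\<close>, but gives
    \<open>i \<le> N i\<close>, so positivity holds from \<open>i = 1\<close> on.\<close>
  have N_pos: "\<forall>\<^sub>F i in sequentially. 0 < N i"
    using eventually_gt_at_top[of 0]
    by eventually_elim (use seq_suble[OF N] in \<open>auto intro: less_le_trans\<close>)
  have "(\<lambda>i. (\<Sum>k=1..N i. a (k + j)) / real (N i) - (\<Sum>k=1..N i. a k) / real (N i)) \<longlonglongrightarrow> 0"
    using LIMSEQ_subseq_LIMSEQ[OF cesaro_shift[of a C j, OF a_bound] N] by (simp add: o_def)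
  moreover have "\<forall>\<^sub>F i in sequentially.
      (\<Sum>k=1..N i. a (k + j)) / real (N i) - (\<Sum>k=1..N i. a k) / real (N i)
      = (\<integral>x. g x \<partial>avg_dual P \<tau> (N i) \<nu>) - (\<integral>x. \<phi> x \<partial>avg_dual P \<tau> (N i) \<nu>)"
    using N_pos by eventually_elim (simp add: avg_\<phi> avg_g)
  ultimately have "(\<lambda>i. (\<integral>x. g x \<partial>avg_dual P \<tau> (N i) \<nu>) - (\<integral>x. \<phi> x \<partial>avg_dual P \<tau> (N i) \<nu>)) \<longlonglongrightarrow> 0"
    by (rule Lim_transform_eventually)
  moreover have "(\<lambda>i. (\<integral>x. g x \<partial>avg_dual P \<tau> (N i) \<nu>) - (\<integral>x. \<phi> x \<partial>avg_dual P \<tau> (N i) \<nu>))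
      \<longlonglongrightarrow> (\<integral>x. g x \<partial>\<rho>) - (\<integral>x. \<phi> x \<partial>\<rho>)"
    using lim g \<phi> by (intro tendsto_diff) (auto simp: weakly_converges_def)
  ultimately have "(\<integral>x. g x \<partial>\<rho>) = (\<integral>x. \<phi> x \<partial>\<rho>)"
    using LIMSEQ_unique by fastforce
  then show "(\<integral>x. \<phi> x \<partial>(\<rho> \<bind> P ?t)) = (\<integral>x. \<phi> x \<partial>\<rho>)"
    using g_int[OF \<rho>] by simp
qed

section \<open>The periodic family\<close>

lemma nonneg_shift_iff:
  fixes s \<tau> :: real
  assumes "0 < \<tau>"
  shows "0 \<le> s + of_int k * \<tau> \<longleftrightarrow> \<lceil>- s / \<tau>\<rceil> \<le> k"
proof -
  have "\<lceil>- s / \<tau>\<rceil> \<le> k \<longleftrightarrow> - s / \<tau> \<le> of_int k"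
    by (rule ceiling_le_iff)
  also have "\<dots> \<longleftrightarrow> - s \<le> of_int k * \<tau>"
    by (rule pos_divide_le_eq[OF assms])
  finally show ?thesis
    by linarith
qed

text \<open>The integers are unbounded below, so \<open>LEAST\<close> need not be attained in
  general; the ceiling exhibits the minimum explicitly.\<close>

lemma Least_int_shift:
  fixes s \<tau> :: real
  assumes "0 < \<tau>"
  shows "(LEAST k::int. 0 \<le> s + of_int k * \<tau>) = \<lceil>- s / \<tau>\<rceil>"
  unfolding nonneg_shift_iff[OF assms] by (rule Least_equality) auto

text \<open>Closedness of the sections makes having support in \<open>L s\<close> equivalent to
  giving \<open>L s\<close> full mass, keeps the weak limit on \<open>L 0\<close>, and permits the
  Tietze extension. The first conjunct reconciles the two meanings of the measure at time 0: the
  given limit and the member of the constructed family.\<close>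

theorem theorem4p3:
  fixes P :: "real \<Rightarrow> 'a::polish_space \<Rightarrow> 'a measure"
    and L :: "real \<Rightarrow> 'a set"
    and \<tau> :: real
    and \<nu> \<rho>0 :: "'a measure"
    and N :: "nat \<Rightarrow> nat"
  assumes "\<tau> > 0"
    and "markov_semigroup P"
    and "poincare_sections P \<tau> L"
    and "\<And>s. closed (L s)"
    and "feller_on P (L 0)"
    and "\<nu> \<in> borel_probs"
    and "measure_supp \<nu> \<subseteq> L 0"
    and "strict_mono N"
    and "\<rho>0 \<in> borel_probs"
    and "weakly_converges (\<lambda>i. avg_dual P \<tau> (N i) \<nu>) \<rho>0"
  shows "section_family P \<tau> (L 0) \<rho>0 0 = \<rho>0 \<and>
         periodic_measure P \<tau> (section_family P \<tau> (L 0) \<rho>0) \<and>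
         (\<forall>s. measure_supp (section_family P \<tau> (L 0) \<rho>0 s) \<subseteq> L s \<and>
              emeasure (section_family P \<tau> (L 0) \<rho>0 s) (L s) = 1)"
proof -
  note \<tau> = assms(1) and P = assms(2) and L = assms(3) and closed = assms(4) and \<nu> = assms(6)
    and \<rho> = assms(9)
  let ?\<rho> = "section_family P \<tau> (L 0) \<rho>0"
  have "emeasure \<nu> (L 0) = 1"
    using measure_supp_subset_iff[OF \<nu> closed] assms(7) by simp
  then have avg: "emeasure (avg_dual P \<tau> n \<nu>) (L 0) = 1" if "0 < n" for n
    using avg_dual_section[OF P \<tau> \<nu> that L closed] by simp
  have "\<forall>\<^sub>F i in sequentially. 0 < N i"
    using eventually_gt_at_top[of 0]
    by eventually_elim (use seq_suble[OF assms(8)] in \<open>auto intro: less_le_trans\<close>)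
  then have "\<forall>\<^sub>F i in sequentially. avg_dual P \<tau> (N i) \<nu> \<in> borel_probs
      \<and> emeasure (avg_dual P \<tau> (N i) \<nu>) (L 0) = 1"
    by eventually_elim (use avg avg_dual_borel_probs[OF P \<tau> \<nu>] in auto)
  then have \<rho>L: "emeasure \<rho>0 (L 0) = 1"
    by (rule weak_limit_closed[OF assms(10) \<rho> closed])
  have inv: "\<rho>0 \<bind> P (real j * \<tau>) = \<rho>0" for j
    by (rule weak_limit_invariant[OF P \<tau> \<nu> closed assms(5,8) avg \<rho> \<rho>L assms(10)])

  define Q where "Q t = \<rho>0 \<bind> P t" for t
  have Q_bind: "Q s \<bind> P t = Q (s + t)" if "0 \<le> s" "0 \<le> t" for s t
    unfolding Q_def using markov_semigroup_bind_bind[OF P that \<rho>] .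
  \<comment> \<open>Invariance under whole periods makes the forward orbit of \<open>\<rho>0\<close>
    periodic: the first \<open>j\<close> periods are absorbed into the initial law.\<close>
  have Q_per_nat: "Q (real j * \<tau> + t) = Q t" if "0 \<le> t" for j t
    using Q_bind[of "real j * \<tau>" t] inv[of j] that \<tau> by (simp add: Q_def)
  have Q_per: "Q (s + of_int k * \<tau>) = Q (s + of_int l * \<tau>)"
    if "0 \<le> s + of_int k * \<tau>" "0 \<le> s + of_int l * \<tau>" for s k l
  proof -
    have *: "Q (s + of_int k * \<tau>) = Q (s + of_int l * \<tau>)"
      if "0 \<le> s + of_int k * \<tau>" "k \<le> l" for k l
    proof -
      have "s + of_int l * \<tau> = real (nat (l - k)) * \<tau> + (s + of_int k * \<tau>)"
        using that(2) by (simp add: of_nat_nat algebra_simps)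
      then show ?thesis
        using Q_per_nat[OF that(1), of "nat (l - k)"] by (simp only:)
    qed
    show ?thesis
      using *[of k l] *[of l k, symmetric] that linorder_linear[of k l] by blast
  qed
  have shift: "\<exists>k::int. 0 \<le> s + of_int k * \<tau>" for s
    using nonneg_shift_iff[OF \<tau>] by blast
  \<comment> \<open>Every shift to a nonnegative time computes the same measure, not just the least
    one. Each later claim can therefore choose a convenient \<open>k\<close>, and the sign of
    \<open>s\<close> no longer matters.\<close>
  have family: "?\<rho> s = Q (s + of_int k * \<tau>)" if k: "0 \<le> s + of_int k * \<tau>" for s k
  proof (cases "0 \<le> s")
    case True
    then show ?thesis
      using Q_per[of s 0 k] k push_from_eq_bind[OF P True \<rho> closed \<rho>L]
      by (simp add: section_family_def Q_def)
  next
    case False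
    let ?l = "\<lceil>- s / \<tau>\<rceil>"
    have l: "0 \<le> s + of_int ?l * \<tau>"
      by (simp only: nonneg_shift_iff[OF \<tau>])
    show ?thesis
      using False Q_per[OF l k] push_from_eq_bind[OF P l \<rho> closed \<rho>L]
      by (simp add: section_family_def Least_int_shift[OF \<tau>] Q_def)
  qed
  have L_add: "L (s + real j * \<tau>) = L s" for s j
  proof (induction j)
    case (Suc j)
    have "L (s + real (Suc j) * \<tau>) = L ((s + real j * \<tau>) + \<tau>)"
      by (simp add: algebra_simps)
    with Suc L show ?case
      by (simp add: poincare_sections_def)
  qed simp
  have L_per: "L (s + of_int k * \<tau>) = L s" for s k
  proof (cases "0 \<le> k")
    case True
    then show ?thesis using L_add[of s "nat k"] by (simp add: of_nat_nat)
  next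
    case False
    \<comment> \<open>A negative shift is undone by adding \<open>- k\<close> periods to the shifted
      point.\<close>
    then show ?thesis using L_add[of "s + of_int k * \<tau>" "nat (- k)"] by (simp add: of_nat_nat)
  qed
  have prob: "?\<rho> s \<in> borel_probs" and sect: "emeasure (?\<rho> s) (L s) = 1" for s
  proof -
    obtain k :: int where k: "0 \<le> s + of_int k * \<tau>" using shift by blast
    note K = markov_semigroup_measurable[OF P k]
    show "?\<rho> s \<in> borel_probs"
      using borel_probs_bind[OF \<rho> K] family[OF k] by (simp add: Q_def)
    have "emeasure (P (s + of_int k * \<tau>) x) (L s) = 1" if "x \<in> L 0" for x
    proof -
      have "emeasure (P (s + of_int k * \<tau>) x) (L (0 + (s + of_int k * \<tau>))) = 1"
        using L that k unfolding poincare_sections_def by blast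
      then show ?thesis by (simp add: L_per)
    qed
    then have "AE x in \<rho>0. emeasure (P (s + of_int k * \<tau>) x) (L s) = 1"
      using borel_prob_emeasure_eq_1_iff[OF \<rho> closed] \<rho>L by auto
    from prob_kernel_AE_bind[OF \<rho> K closed this]
    show "emeasure (?\<rho> s) (L s) = 1"
      using family[OF k] by (simp add: Q_def)
  qed
  have "?\<rho> 0 = \<rho>0"
    \<comment> \<open>Here \<open>family\<close> yields only \<open>\<rho>0 \<bind> P 0\<close>;
      invariance for \<open>j = 0\<close> turns this into \<open>\<rho>0\<close>.\<close>
    using family[of 0 0] inv[of 0] by (simp add: Q_def)
  moreover have "periodic_measure P \<tau> ?\<rho>"
    unfolding periodic_measure_def
  proof (intro conjI allI ballI impI)
    show "?\<rho> s \<in> borel_probs" for s by (rule prob)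
    fix s
    obtain k :: int where k: "0 \<le> s + of_int k * \<tau>" using shift by blast
    \<comment> \<open>Lowering the shift by one compensates the added period, so both sides are read
      off at the same nonnegative time.\<close>
    have eq: "s + \<tau> + of_int (k - 1) * \<tau> = s + of_int k * \<tau>"
      by (simp add: algebra_simps)
    show "?\<rho> (s + \<tau>) = ?\<rho> s"
      using family[OF k] family[of "s + \<tau>" "k - 1"] k unfolding eq by simp
    fix t :: real and B :: "'a set" assume t: "0 \<le> t" and B: "B \<in> sets borel"
    \<comment> \<open>A shift admissible for \<open>s\<close> stays admissible for
      \<open>t + s\<close>, so the evolution law reduces to the semigroup property of
      \<open>Q\<close>.\<close>
    have "?\<rho> (t + s) = Q ((s + of_int k * \<tau>) + t)"
      using family[of "t + s" k] k t by (simp add: algebra_simps)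
    also have "\<dots> = ?\<rho> s \<bind> P t"
      using Q_bind[OF k t] family[OF k] by simp
    finally show "emeasure (?\<rho> (t + s)) B = (\<integral>\<^sup>+x. emeasure (P t x) B \<partial>?\<rho> s)"
      using emeasure_bind_prob_algebra[OF prob markov_semigroup_measurable[OF P t] B] by simp
  qed
  moreover have "measure_supp (?\<rho> s) \<subseteq> L s" for s
    using measure_supp_subset_iff[OF prob closed] sect by blast
  ultimately show ?thesis
    using sect by blast
qed

end
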